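(* Let $\gamma:\mathbb{R}/\mathbb{Z}\to\mathbb{R}^3$ be an arclength parametrized tame knot with local distortion $\delta(\gamma(\mathbb{R}/\mathbb{Z}),r_\gamma)<g_3$ at some scale $r_\gamma>0$. Then for every $h\in C^{0,1}(\mathbb{R}/\mathbb{Z},\mathbb{R}^3)$ there exists $\epsilon_{\gamma,h}>0$ such that $\gamma_\epsilon:=\gamma+\epsilon h$ is an immersed knot equivalent to $\gamma$ for all $\epsilon\in\mathbb{R}$ with $|\epsilon|\le\epsilon_{\gamma,h}$.
   Context: A knot is an injective continuous map $\mathbb{R}/\mathbb{Z}\to\mathbb{R}^3$. Two knots $\gamma_1,\gamma_2$ are equivalent if there is a homeomorphism $h:\mathbb{R}^3\to\mathbb{R}^3$ (not necessarily orientation preserving) mapping $\gamma_1(\mathbb{R}/\mathbb{Z})$ onto $\gamma_2(\mathbb{R}/\mathbb{Z})$. A knot is tame if it is equivalent to a polygonal knot. A curve is arclength parametrized if it is Lipschitz with $|\gamma'|=1$ a.e. A Lipschitz curve $\gamma$ is called immersed if $\operatorname{essinf}_{u\in\mathbb{R}/\mathbb{Z}}|\gamma'(u)|>0$. $C^{0,1}$ denotes the Lipschitz continuous maps. For a closed, path-connected set $M\subset\mathbb{R}^3$, $d_M(x,y)$ is the length of the shortest curve in $M$ connecting $x,y\in M$, and $\delta(M,r):=\sup_{x,y\in M,\ 0<|x-y|\le 2r}\frac{d_M(x,y)}{|x-y|}$ for $r>0$. The constant is $g_3:=\frac{2}{\sqrt3}\arcsin\frac{\sqrt3}{2}$. 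*)

theory Defs
  imports "HOL-Analysis.Analysis" "HOL-Probability.Essential_Supremum"
begin

text \<open>
  Maps on \<open>\<real>/\<int>\<close> are represented by their lifts, i.e. 1-periodic functions on \<^typ>\<open>real\<close>
  (\<^const>\<open>periodic_fun_simple'\<close>). Continuity, Lipschitz continuity, derivatives and almost
  everywhere statements agree for a map and its lift, and the image of the map is the range of
  the lift.
\<close>

definition knot :: "(real \<Rightarrow> real^3) \<Rightarrow> bool" where
  "knot \<gamma> \<longleftrightarrow> periodic_fun_simple' \<gamma> \<and> continuous_on UNIV \<gamma> \<and>
     (\<forall>s t. \<gamma> s = \<gamma> t \<longrightarrow> s - t \<in> \<int>)"

definition knot_equivalent :: "(real \<Rightarrow> real^3) \<Rightarrow> (real \<Rightarrow> real^3) \<Rightarrow> bool" where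
  "knot_equivalent \<gamma>\<^sub>1 \<gamma>\<^sub>2 \<longleftrightarrow>
     (\<exists>h k. homeomorphism UNIV UNIV h k \<and> h ` range \<gamma>\<^sub>1 = range \<gamma>\<^sub>2)"

text \<open>Piecewise affine with finitely many pieces; breakpoints may be spurious, so it is no
  restriction that 0 is one of them.\<close>

definition polygonal_knot :: "(real \<Rightarrow> real^3) \<Rightarrow> bool" where
  "polygonal_knot \<gamma> \<longleftrightarrow> knot \<gamma> \<and>
     (\<exists>n::nat. \<exists>t::nat \<Rightarrow> real. t 0 = 0 \<and> t n = 1 \<and> (\<forall>i<n. t i < t (Suc i)) \<and>
        (\<forall>i<n. \<forall>s\<in>{0..1}.
           \<gamma> (linepath (t i) (t (Suc i)) s) = linepath (\<gamma> (t i)) (\<gamma> (t (Suc i))) s))"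

definition tame_knot :: "(real \<Rightarrow> real^3) \<Rightarrow> bool" where
  "tame_knot \<gamma> \<longleftrightarrow> knot \<gamma> \<and> (\<exists>p. polygonal_knot p \<and> knot_equivalent \<gamma> p)"

text \<open>The class \<open>C\<^sup>0\<^sup>,\<^sup>1(\<real>/\<int>, \<real>\<^sup>3)\<close>.\<close>

definition lipschitz_curve :: "(real \<Rightarrow> real^3) \<Rightarrow> bool" where
  "lipschitz_curve \<gamma> \<longleftrightarrow> periodic_fun_simple' \<gamma> \<and> (\<exists>L. L-lipschitz_on UNIV \<gamma>)"

definition arclength_parametrized :: "(real \<Rightarrow> real^3) \<Rightarrow> bool" where
  "arclength_parametrized \<gamma> \<longleftrightarrow> lipschitz_curve \<gamma> \<and>
     (AE u in lebesgue. \<gamma> differentiable (at u) \<and> norm (vector_derivative \<gamma> (at u)) = 1)"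

definition essinf :: "'a measure \<Rightarrow> ('a \<Rightarrow> real) \<Rightarrow> ereal" where
  "essinf M f = - esssup M (\<lambda>x. - ereal (f x))"

text \<open>A Lipschitz curve is differentiable almost everywhere, so the values of
  \<^const>\<open>vector_derivative\<close> at other points do not influence the essential infimum.\<close>

definition immersed :: "(real \<Rightarrow> real^3) \<Rightarrow> bool" where
  "immersed \<gamma> \<longleftrightarrow> lipschitz_curve \<gamma> \<and>
     essinf lebesgue (\<lambda>u. norm (vector_derivative \<gamma> (at u))) > 0"

text \<open>Length of a curve on the unit interval as total variation, infinite if the curve is not
  rectifiable.\<close>

definition curve_length :: "(real \<Rightarrow> real^3) \<Rightarrow> ennreal" where
  "curve_length g = (SUP (n, t) \<in> {(n::nat, t::nat \<Rightarrow> real). mono t \<and> range t \<subseteq> {0..1}}.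
     \<Sum>i<n. ennreal (dist (g (t i)) (g (t (Suc i)))))"

text \<open>\<open>intrinsic_dist M x y\<close> is \<open>d\<^sub>M(x,y)\<close>. For closed \<open>M\<close> a finite infimum is attained; the value
  is infinite if \<open>x\<close> and \<open>y\<close> are not connected by a rectifiable curve in \<open>M\<close>.\<close>

definition intrinsic_dist :: "(real^3) set \<Rightarrow> real^3 \<Rightarrow> real^3 \<Rightarrow> ennreal" where
  "intrinsic_dist M x y =
     (INF g \<in> {g. path g \<and> path_image g \<subseteq> M \<and> pathstart g = x \<and> pathfinish g = y}.
        curve_length g)"

definition local_distortion :: "(real^3) set \<Rightarrow> real \<Rightarrow> ennreal" where
  "local_distortion M r =
     (SUP (x, y) \<in> {(x, y). x \<in> M \<and> y \<in> M \<and> 0 < dist x y \<and> dist x y \<le> 2 * r}.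
        intrinsic_dist M x y / ennreal (dist x y))"

definition g\<^sub>3 :: real where
  "g\<^sub>3 = 2 / sqrt 3 * arcsin (sqrt 3 / 2)"

end

theory Submission
  imports Defs
begin

text \<open>
  The perturbation \<open>\<gamma> + \<epsilon> h\<close> is \<open>\<gamma>\<close> followed by a small Lipschitz perturbation of the identity of
  \<open>\<real>\<^sup>3\<close>. Suppose that \<open>|h s - h t| \<le> C |\<gamma> s - \<gamma> t|\<close> for all parameters. Then \<open>\<gamma> u \<mapsto> h u\<close> is a well
  defined \<open>C\<close>-Lipschitz map on the knot, and it extends to a Lipschitz map \<open>H\<close> on \<open>\<real>\<^sup>3\<close>
  (\<open>lipschitz_extension\<close>). As soon as \<open>\<epsilon> H\<close> is a contraction, \<open>x \<mapsto> x + \<epsilon> H x\<close> is a homeomorphism of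
  \<open>\<real>\<^sup>3\<close> by Banach's fixed point theorem (\<open>homeomorphism_id_plus_contraction\<close>). It carries \<open>\<gamma> u\<close> to
  \<open>\<gamma> u + \<epsilon> h u\<close>, so the perturbed curve is an equivalent knot.

  The estimate on \<open>h\<close> comes from the distortion bound (\<open>lipschitz_curve_dist_le_knot_dist\<close>). Points
  of the knot farther apart than \<open>2 r\<close> are harmless, because \<open>h\<close> has bounded oscillation. Nearby
  points \<open>\<gamma> s\<close> and \<open>\<gamma> t\<close> are joined inside the knot by a path of length at most a multiple of
  \<open>|\<gamma> s - \<gamma> t|\<close>. Such a path lifts to the parameter line (\<open>knot_path_lift\<close>), hence sweeps out a whole
  parameter interval from \<open>s\<close> to some \<open>t + k\<close> with \<open>k\<close> an integer; as \<open>|\<gamma>'| = 1\<close> almost everywhere,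
  its length is comparable to \<open>|t + k - s|\<close> from below (\<open>curve_length_ge_parameter_distance\<close>). The
  Lipschitz bound for the periodic map \<open>h\<close> does the rest.

  Finally \<open>|\<gamma>' + \<epsilon> h'| \<ge> 1 - |\<epsilon>| L\<close> wherever both derivatives exist. That this is almost everywhere
  is the one-dimensional theorem of Rademacher (\<open>Lipschitz_differentiable_ae\<close>), obtained here from the
  Vitali covering theorem. It is also what makes the derivative measurable, so that its essential
  infimum is meaningful.
\<close>

section \<open>Lipschitz maps on Euclidean space\<close>

text \<open>McShane's formula: the extension is the lower envelope of the cones of slope \<open>L\<close> that stand on
  the graph.\<close>

lemma lipschitz_extension_real:
  fixes f :: "'a::metric_space \<Rightarrow> real"
  assumes L: "L-lipschitz_on S f"
  obtains F where "L-lipschitz_on UNIV F" "\<And>x. x \<in> S \<Longrightarrow> F x = f x"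
proof (cases "S = {}")
  case True
  have "L \<ge> 0" using L by (rule lipschitz_on_nonneg)
  then show ?thesis using True by (intro that[of "\<lambda>_. 0"]) (auto intro: lipschitz_on_leI lipschitz_onI)
next
  case False
  have L0: "L \<ge> 0" using L by (rule lipschitz_on_nonneg)
  define F where "F x = (INF y\<in>S. f y + L * dist x y)" for x
  have bdd: "bdd_below ((\<lambda>y. f y + L * dist x y) ` S)" for x
  proof -
    obtain y0 where y0: "y0 \<in> S" using False by auto
    have "f y0 - L * dist x y0 \<le> f y + L * dist x y" if "y \<in> S" for y
    proof -
      have "f y0 - f y \<le> L * dist y0 y"
        using lipschitz_onD[OF L y0 that] by (auto simp: dist_real_def)
      also have "\<dots> \<le> L * (dist x y0 + dist x y)"
        by (intro mult_left_mono L0) (metis dist_commute dist_triangle)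
      finally show ?thesis by (simp add: algebra_simps)
    qed
    then show ?thesis by (auto intro!: bdd_belowI2)
  qed
  have one: "F x \<le> F x' + L * dist x x'" for x x'
  proof -
    have "F x - L * dist x x' \<le> f y + L * dist x' y" if "y \<in> S" for y
    proof -
      have "F x \<le> f y + L * dist x y"
        unfolding F_def using bdd that by (rule cINF_lower)
      also have "L * dist x y \<le> L * (dist x x' + dist x' y)"
        by (intro mult_left_mono L0 dist_triangle)
      finally show ?thesis by (simp add: algebra_simps)
    qed
    then have "F x - L * dist x x' \<le> F x'"
      unfolding F_def[of x'] using False by (intro cINF_greatest)
    then show ?thesis by simp
  qed
  show ?thesis
  proof (rule that)
    show "L-lipschitz_on UNIV F"
      using one[of _ _] by (intro lipschitz_onI L0) (smt (verit) dist_commute dist_real_def)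
    fix x assume x: "x \<in> S"
    show "F x = f x"
    proof (rule antisym)
      show "F x \<le> f x"
        unfolding F_def using cINF_lower[OF bdd x, of x] by simp
      have "f x \<le> f y + L * dist x y" if "y \<in> S" for y
        using lipschitz_onD[OF L x that] by (auto simp: dist_real_def)
      then show "f x \<le> F x"
        unfolding F_def using False by (intro cINF_greatest)
    qed
  qed
qed

text \<open>Each coordinate is extended separately. The loss of a factor in the constant, which
  Kirszbraun's theorem would avoid, is harmless when the map is later multiplied by a small number.\<close>

lemma lipschitz_extension:
  fixes f :: "'a::metric_space \<Rightarrow> 'b::euclidean_space"
  assumes L: "L-lipschitz_on S f"
  obtains F where "(real DIM('b) * L)-lipschitz_on UNIV F" "\<And>x. x \<in> S \<Longrightarrow> F x = f x"
proof -
  have L0: "L \<ge> 0" using L by (rule lipschitz_on_nonneg)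
  have "\<exists>g. L-lipschitz_on UNIV g \<and> (\<forall>x\<in>S. g x = f x \<bullet> b)" if "b \<in> Basis" for b
  proof -
    have "L-lipschitz_on S (\<lambda>x. f x \<bullet> b)"
    proof (rule lipschitz_onI[OF _ L0])
      fix x y assume xy: "x \<in> S" "y \<in> S"
      have "dist (f x \<bullet> b) (f y \<bullet> b) \<le> dist (f x) (f y)"
        using Basis_le_norm[OF that, of "f x - f y"] by (simp add: dist_norm inner_diff_left)
      then show "dist (f x \<bullet> b) (f y \<bullet> b) \<le> L * dist x y"
        using lipschitz_onD[OF L xy] by linarith
    qed
    from lipschitz_extension_real[OF this] show ?thesis by metis
  qed
  then obtain g where g: "\<And>b. b \<in> Basis \<Longrightarrow> L-lipschitz_on UNIV (g b)"
    and gf: "\<And>b x. b \<in> Basis \<Longrightarrow> x \<in> S \<Longrightarrow> g b x = f x \<bullet> b"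
    by metis
  define F where "F x = (\<Sum>b\<in>Basis. g b x *\<^sub>R b)" for x
  show ?thesis
  proof (rule that[of F])
    show "(real DIM('b) * L)-lipschitz_on UNIV F"
    proof (rule lipschitz_onI)
      fix x y
      have "dist (F x) (F y) = norm (\<Sum>b\<in>Basis. (g b x - g b y) *\<^sub>R b)"
        by (simp add: F_def dist_norm scaleR_diff_left sum_subtractf)
      also have "\<dots> \<le> (\<Sum>b\<in>(Basis::'b set). L * dist x y)"
        using lipschitz_onD[OF g] by (intro sum_norm_le) (auto simp: dist_real_def)
      finally show "dist (F x) (F y) \<le> real DIM('b) * L * dist x y" by simp
    qed (use L0 in simp)
    show "F x = f x" if "x \<in> S" for x
      using that by (simp add: F_def gf euclidean_representation)
  qed
qed

text \<open>The equation \<open>x + H x = y\<close> asks for a fixed point of the contraction \<open>x \<mapsto> y - H x\<close>. The map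
  shrinks distances by at most the factor \<open>1 - c\<close>, so the inverse is Lipschitz.\<close>

lemma homeomorphism_id_plus_contraction:
  fixes H :: "'a::banach \<Rightarrow> 'a"
  assumes H: "c-lipschitz_on UNIV H" and c: "c < 1"
  obtains k where "homeomorphism UNIV UNIV (\<lambda>x. x + H x) k"
proof -
  have c0: "c \<ge> 0" using H by (rule lipschitz_on_nonneg)
  define \<Phi> where "\<Phi> x = x + H x" for x
  have exp: "(1 - c) * dist x y \<le> dist (\<Phi> x) (\<Phi> y)" for x y
  proof -
    have "dist x y \<le> norm (\<Phi> x - \<Phi> y) + norm (H x - H y)"
      unfolding \<Phi>_def dist_norm
      using norm_triangle_ineq4[of "x + H x - (y + H y)" "H x - H y"] by simp
    also have "norm (H x - H y) \<le> c * dist x y"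
      using lipschitz_onD[OF H, of x y] by (simp add: dist_norm)
    finally show ?thesis by (simp add: dist_norm algebra_simps)
  qed
  have "\<exists>x. \<Phi> x = y" for y
  proof -
    have "\<exists>!x. y - H x = x"
    proof (rule banach_fix_type[OF c0 c], intro allI)
      fix x x'
      show "dist (y - H x) (y - H x') \<le> c * dist x x'"
        using lipschitz_onD[OF H, of x x'] by (simp add: dist_norm norm_minus_commute)
    qed
    then obtain x where "y - H x = x" by blast
    then have "\<Phi> x = y" by (simp add: \<Phi>_def) (metis add_diff_cancel_left' diff_add_cancel)
    then show ?thesis ..
  qed
  then obtain k where k: "\<And>y. \<Phi> (k y) = y" by metis
  have inj: "x = x'" if "\<Phi> x = \<Phi> x'" for x x'
    using exp[of x x'] that c by (simp add: mult_le_0_iff)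
  have "(1 / (1 - c))-lipschitz_on UNIV k"
  proof (rule lipschitz_onI)
    fix y y'
    show "dist (k y) (k y') \<le> 1 / (1 - c) * dist y y'"
      using exp[of "k y" "k y'"] c by (simp add: k field_simps)
  qed (use c in simp)
  then have "continuous_on UNIV k" by (rule lipschitz_on_continuous_on)
  moreover have "continuous_on UNIV \<Phi>"
    unfolding \<Phi>_def using lipschitz_on_continuous_on[OF H] by (intro continuous_intros)
  ultimately have "homeomorphism UNIV UNIV \<Phi> k"
    by (auto simp: homeomorphism_def k inj surj_def) (metis k inj)+
  then show ?thesis using that unfolding \<Phi>_def by blast
qed

section \<open>Almost everywhere differentiability of Lipschitz functions\<close>

text \<open>If every point of \<open>E\<close> lies in arbitrarily short intervals that \<open>\<phi>\<close> stretches by a factor at most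
  \<open>c\<close>, then \<open>\<phi>\<close> stretches \<open>E\<close> by at most \<open>c\<close>. By Vitali, countably many disjoint such intervals inside
  an open set slightly larger than \<open>E\<close> cover \<open>E\<close> up to a null set, and the Lipschitz map \<open>\<phi>\<close> sends
  that null set to a null set.\<close>

lemma emeasure_monotone_image_le:
  fixes \<phi> :: "real \<Rightarrow> real"
  assumes mono: "strict_mono \<phi>" and lip: "K-lipschitz_on UNIV \<phi>"
    and E: "E \<in> sets lebesgue" and c: "c > 0"
    and fine: "\<And>x d. x \<in> E \<Longrightarrow> d > 0 \<Longrightarrow>
      \<exists>a b. a < b \<and> x \<in> {a..b} \<and> b - a < d \<and> \<phi> b - \<phi> a \<le> c * (b - a)"
  shows "emeasure lebesgue (\<phi> ` E) \<le> ennreal c * emeasure lebesgue E"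
proof (rule ennreal_le_epsilon)
  fix e :: real assume e: "0 < e"
  obtain U where U: "open U" "E \<subseteq> U" "U - E \<in> lmeasurable"
    "emeasure lebesgue (U - E) < ennreal (e / c)"
    using sets_lebesgue_outer_open[OF E, of "e / c"] e c by auto
  have Uleb: "U \<in> sets lebesgue" using U(1) by auto
  define K where "K = {(x, r). 0 < r \<and> cball x r \<subseteq> U \<and> \<phi> (x + r) - \<phi> (x - r) \<le> c * (2 * r)}"
  have fineK: "\<exists>i. i \<in> K \<and> x \<in> cball (fst i) (snd i) \<and> snd i < d" if x: "x \<in> E" and d: "0 < d" for x d
  proof -
    obtain d' where d': "d' > 0" "ball x d' \<subseteq> U" using U(1,2) x by (meson open_contains_ball subsetD)
    obtain a b where ab: "a < b" "x \<in> {a..b}" "b - a < min d d'" "\<phi> b - \<phi> a \<le> c * (b - a)"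
      using fine[OF x, of "min d d'"] d d' by auto
    have *: "(a + b) / 2 - (b - a) / 2 = a" "(a + b) / 2 + (b - a) / 2 = b" by (auto simp: field_simps)
    have "cball ((a + b) / 2) ((b - a) / 2) = {a..b}"
      unfolding cball_eq_atLeastAtMost * ..
    moreover have "{a..b} \<subseteq> ball x d'" using ab by (auto simp: dist_real_def)
    ultimately have "((a + b) / 2, (b - a) / 2) \<in> K \<and> x \<in> cball ((a + b) / 2) ((b - a) / 2) \<and> (b - a) / 2 < d"
      using ab d' by (auto simp: K_def * simp del: distrib_left_numeral right_diff_distrib_numeral)
    then show ?thesis by (intro exI[of _ "((a + b) / 2, (b - a) / 2)"]) simp
  qed
  have posK: "0 < snd i" if "i \<in> K" for i using that by (auto simp: K_def)
  obtain C where C: "countable C" "C \<subseteq> K"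
    "pairwise (\<lambda>i j. disjnt (cball (fst i) (snd i)) (cball (fst j) (snd j))) C"
    "negligible (E - (\<Union>i\<in>C. cball (fst i) (snd i)))"
    by (rule Vitali_covering_theorem_cballs[OF posK fineK]) (assumption | rule that)+
  define B where "B i = {fst i - snd i..fst i + snd i}" for i :: "real \<times> real"
  define J where "J i = {\<phi> (fst i - snd i)..\<phi> (fst i + snd i)}" for i
  have B: "cball (fst i) (snd i) = B i" for i by (simp add: B_def cball_eq_atLeastAtMost)
  let ?N = "E - (\<Union>i\<in>C. B i)"
  have le_iff: "\<phi> x \<le> \<phi> y \<longleftrightarrow> x \<le> y" for x y
    using strict_mono_less_eq[OF mono] .
  have pos: "snd i > 0" if "i \<in> C" for i using that C(2) by (auto simp: K_def)
  have subU: "B i \<subseteq> U" if "i \<in> C" for i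
    unfolding B[symmetric] using subsetD[OF C(2) that] by (simp add: K_def split_beta)
  have disjB: "disjoint_family_on B C"
    using C(3) unfolding B disjoint_family_on_def pairwise_def disjnt_def by blast
  have disjJ: "disjoint_family_on J C"
    unfolding disjoint_family_on_def
  proof (intro ballI impI)
    fix i j assume ij: "i \<in> C" "j \<in> C" "i \<noteq> j"
    then have "B i \<inter> B j = {}" using disjB by (auto simp: disjoint_family_on_def)
    then have "fst i + snd i < fst j - snd j \<or> fst j + snd j < fst i - snd i"
      using pos[OF ij(1)] pos[OF ij(2)] unfolding B_def by force
    then show "J i \<inter> J j = {}"
      unfolding J_def using le_iff by (auto simp: not_le[symmetric])
  qed
  have Nneg: "negligible (\<phi> ` ?N)"
  proof (rule negligible_locally_Lipschitz_image)
    show "negligible ?N" using C(4) by (simp add: B)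
    show "\<exists>T B. open T \<and> x \<in> T \<and> (\<forall>y\<in>?N \<inter> T. norm (\<phi> y - \<phi> x) \<le> B * norm (y - x))" for x
      using lipschitz_onD[OF lip] by (intro exI[of _ UNIV] exI[of _ K]) (auto simp: dist_norm)
  qed simp
  have "\<phi> ` E \<subseteq> \<phi> ` ?N \<union> (\<Union>i\<in>C. J i)"
  proof
    fix z assume "z \<in> \<phi> ` E"
    then obtain x where "x \<in> E" "z = \<phi> x" by auto
    then show "z \<in> \<phi> ` ?N \<union> (\<Union>i\<in>C. J i)"
      by (cases "x \<in> ?N") (auto simp: B_def J_def le_iff)
  qed
  moreover have UJ: "(\<Union>i\<in>C. J i) \<in> sets lebesgue"
    using C(1) by (intro sets.countable_UN') (auto simp: J_def)
  ultimately have "emeasure lebesgue (\<phi> ` E) \<le> emeasure lebesgue (\<phi> ` ?N \<union> (\<Union>i\<in>C. J i))"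
    using Nneg by (intro emeasure_mono) (auto simp: negligible_iff_null_sets)
  also have "\<dots> \<le> emeasure lebesgue (\<phi> ` ?N) + emeasure lebesgue (\<Union>i\<in>C. J i)"
    using Nneg UJ by (intro emeasure_subadditive) (auto simp: negligible_iff_null_sets)
  also have "emeasure lebesgue (\<phi> ` ?N) = 0"
    using Nneg by (auto simp: negligible_iff_null_sets)
  also have "emeasure lebesgue (\<Union>i\<in>C. J i) = (\<integral>\<^sup>+i. emeasure lebesgue (J i) \<partial>count_space C)"
    using C(1) disjJ by (intro emeasure_UN_countable) (auto simp: J_def[abs_def])
  also have "\<dots> \<le> (\<integral>\<^sup>+i. ennreal c * emeasure lebesgue (B i) \<partial>count_space C)"
  proof (rule nn_integral_mono)
    fix i assume "i \<in> space (count_space C)"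
    then have i: "i \<in> C" by simp
    have "\<phi> (fst i - snd i) \<le> \<phi> (fst i + snd i)" using pos[OF i] by (simp add: le_iff)
    moreover have "\<phi> (fst i + snd i) - \<phi> (fst i - snd i) \<le> c * (2 * snd i)"
      using i C(2) by (auto simp: K_def)
    ultimately show "emeasure lebesgue (J i) \<le> ennreal c * emeasure lebesgue (B i)"
      using pos[OF i] c by (simp add: J_def B_def ennreal_mult[symmetric] ennreal_leI)
  qed
  also have "\<dots> = ennreal c * (\<integral>\<^sup>+i. emeasure lebesgue (B i) \<partial>count_space C)"
    by (intro nn_integral_cmult) auto
  also have "(\<integral>\<^sup>+i. emeasure lebesgue (B i) \<partial>count_space C) = emeasure lebesgue (\<Union>i\<in>C. B i)"
    using C(1) disjB by (intro emeasure_UN_countable[symmetric]) (auto simp: B_def[abs_def])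
  also have "\<dots> \<le> emeasure lebesgue U"
    using subU Uleb by (intro emeasure_mono) auto
  also have "\<dots> = emeasure lebesgue (E \<union> (U - E))"
    using U(2) by (intro arg_cong[where f = "emeasure lebesgue"]) auto
  also have "\<dots> \<le> emeasure lebesgue E + emeasure lebesgue (U - E)"
    using E U(3) by (intro emeasure_subadditive) auto
  also have "\<dots> \<le> emeasure lebesgue E + ennreal (e / c)"
    using U(4) by (intro add_left_mono) simp
  finally have "emeasure lebesgue (\<phi> ` E) \<le> ennreal c * (emeasure lebesgue E + ennreal (e / c))"
    by (simp add: mult_left_mono)
  also have "\<dots> = ennreal c * emeasure lebesgue E + ennreal e"
    using c e by (simp add: distrib_left ennreal_mult[symmetric])
  finally show "emeasure lebesgue (\<phi> ` E) \<le> ennreal c * emeasure lebesgue E + ennreal e" .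
qed


text \<open>Let \<open>p < r\<close> be rational and let \<open>E\<close> be the bounded set of points where the difference quotients
  of \<open>\<phi>\<close> are below \<open>p\<close> and above \<open>r\<close> at arbitrarily small scales. Stretching by at most \<open>p\<close> gives
  \<open>|\<phi> E| \<le> p |E|\<close>. The inverse of \<open>\<phi>\<close> is again Lipschitz because \<open>\<phi>\<close> is expanding, and it stretches
  \<open>\<phi> E\<close> by at most \<open>1/r\<close>, so \<open>|E| \<le> (1/r) |\<phi> E| \<le> (p/r) |E|\<close> and \<open>|E| = 0\<close>. A point where \<open>\<phi>\<close> is
  not differentiable lies in one of these countably many sets.\<close>

lemma expanding_Lipschitz_differentiable_ae:
  fixes \<phi> :: "real \<Rightarrow> real"
  assumes expand: "\<And>x y. x \<le> y \<Longrightarrow> y - x \<le> \<phi> y - \<phi> x"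
    and lip: "K-lipschitz_on UNIV \<phi>"
  shows "negligible {x. \<not> \<phi> differentiable (at x)}"
proof -
  have mono: "strict_mono \<phi>"
    by (rule strict_monoI) (use expand in \<open>force simp: less_eq_real_def\<close>)
  have le_iff: "\<phi> x \<le> \<phi> y \<longleftrightarrow> x \<le> y" and less_iff: "\<phi> x < \<phi> y \<longleftrightarrow> x < y" for x y
    using strict_mono_less_eq[OF mono] strict_mono_less[OF mono] by auto
  have cont: "continuous_on UNIV \<phi>" using lip by (rule lipschitz_on_continuous_on)
  then have contA: "continuous_on A \<phi>" for A by (rule continuous_on_subset) simp
  have "\<exists>x. \<phi> x = y" for y
  proof -
    define a where "a = \<bar>y - \<phi> 0\<bar>"
    have "\<phi> (-a) \<le> y" "y \<le> \<phi> a" using expand[of "-a" 0] expand[of 0 a] by (auto simp: a_def)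
    then show ?thesis using IVT'[of \<phi> "-a" y a] contA by (auto simp: a_def)
  qed
  then obtain g where g: "\<And>y. \<phi> (g y) = y" by metis
  have g': "g (\<phi> x) = x" for x using g[of "\<phi> x"] le_iff by (metis order_antisym order_refl)
  have gmono: "strict_mono g"
    by (rule strict_monoI) (metis g less_iff)
  have glip: "1-lipschitz_on UNIV g"
  proof (rule lipschitz_on_leI)
    fix x y :: real assume "x \<le> y"
    then have "g x \<le> g y" using strict_mono_less_eq[OF gmono] by blast
    then show "dist (g x) (g y) \<le> 1 * dist x y"
      using expand[of "g x" "g y"] \<open>x \<le> y\<close> by (simp add: g dist_real_def)
  qed simp
  define q where "q x h = (\<phi> (x + h) - \<phi> x) / h" for x h
  define lo where "lo p = (\<Inter>n::nat. \<Union>h\<in>{h. h \<noteq> 0 \<and> \<bar>h\<bar> < 1 / (Suc n)}. {x. q x h < p})" for p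
  define hi where "hi p = (\<Inter>n::nat. \<Union>h\<in>{h. h \<noteq> 0 \<and> \<bar>h\<bar> < 1 / (Suc n)}. {x. p < q x h})" for p
  have qcont: "continuous_on UNIV (\<lambda>x. q x h)" for h
    unfolding q_def by (cases "h = 0") (auto intro!: continuous_intros continuous_on_compose2[OF cont])
  \<comment> \<open>Both sets are countable intersections of open sets.\<close>
  have borel: "lo p \<in> sets borel" "hi p \<in> sets borel" for p
    unfolding lo_def hi_def
    by (rule sets.countable_INT'; auto intro!: borel_open open_UN open_Collect_less qcont continuous_on_const)+
  have qint: "\<exists>a b. a < b \<and> x \<in> {a..b} \<and> b - a = \<bar>h\<bar> \<and> \<phi> b - \<phi> a = q x h * (b - a)" if "h \<noteq> 0" for x h
    using that by (intro exI[of _ "min x (x + h)"] exI[of _ "max x (x + h)"])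
      (auto simp: q_def min_def max_def field_simps)
  have null: "negligible (lo p \<inter> hi r \<inter> {-m..m})" if pr: "0 < p" "p < r" for p r m :: real
  proof -
    let ?E = "lo p \<inter> hi r \<inter> {-m..m}"
    have E: "?E \<in> sets borel" using borel by auto
    have img: "\<phi> ` ?E = g -` ?E"
    proof (intro set_eqI iffI)
      show "y \<in> g -` ?E" if "y \<in> \<phi> ` ?E" for y using that by (auto simp only: g' vimage_eq)
      show "y \<in> \<phi> ` ?E" if "y \<in> g -` ?E" for y
        using that by (intro image_eqI[of y \<phi> "g y"]) (simp_all only: g vimage_eq)
    qed
    have "g \<in> borel_measurable borel"
      using lipschitz_on_continuous_on[OF glip] by (rule borel_measurable_continuous_onI)
    then have "g -` ?E \<inter> space borel \<in> sets borel" using E by (rule measurable_sets)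
    then have \<phi>E: "\<phi> ` ?E \<in> sets borel" by (simp add: img)
    have 1: "emeasure lebesgue (\<phi> ` ?E) \<le> ennreal p * emeasure lebesgue ?E"
    proof (rule emeasure_monotone_image_le[OF mono lip _ pr(1)])
      fix x d :: real assume x: "x \<in> ?E" and d: "d > 0"
      obtain n where n: "1 / real (Suc n) < d" using d by (metis nat_approx_posE)
      obtain h where h: "h \<noteq> 0" "\<bar>h\<bar> < 1 / (Suc n)" "q x h < p" using x unfolding lo_def by blast
      obtain a b where ab: "a < b" "x \<in> {a..b}" "b - a = \<bar>h\<bar>" "\<phi> b - \<phi> a = q x h * (b - a)"
        using qint[OF h(1)] by blast
      have "q x h * (b - a) \<le> p * (b - a)" using h(3) ab(1) by (intro mult_right_mono) auto
      then show "\<exists>a b. a < b \<and> x \<in> {a..b} \<and> b - a < d \<and> \<phi> b - \<phi> a \<le> p * (b - a)"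
        using ab h n by (intro exI[of _ a] exI[of _ b]) auto
    qed (use E in auto)
    have r: "0 < 1 / r" using pr by simp
    have "emeasure lebesgue (g ` (\<phi> ` ?E)) \<le> ennreal (1 / r) * emeasure lebesgue (\<phi> ` ?E)"
    proof (rule emeasure_monotone_image_le[OF gmono glip _ r])
      fix y d :: real assume y: "y \<in> \<phi> ` ?E" and d: "d > 0"
      then obtain x where x: "x \<in> ?E" "y = \<phi> x" by auto
      have K: "K \<ge> 0" using lip by (rule lipschitz_on_nonneg)
      then have "d / (K + 1) > 0" using d by simp
      then obtain n where n: "1 / real (Suc n) < d / (K + 1)" by (metis nat_approx_posE)
      obtain h where h: "h \<noteq> 0" "\<bar>h\<bar> < 1 / (Suc n)" "r < q x h" using x unfolding hi_def by blast
      obtain a b where ab: "a < b" "x \<in> {a..b}" "b - a = \<bar>h\<bar>" "\<phi> b - \<phi> a = q x h * (b - a)"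
        using qint[OF h(1)] by blast
      have "r * (b - a) \<le> q x h * (b - a)" using h(3) ab(1) by (intro mult_right_mono) auto
      then have bar: "b - a \<le> 1 / r * (\<phi> b - \<phi> a)" using pr ab(4) by (simp add: field_simps)
      have "\<phi> b - \<phi> a \<le> K * (b - a)"
        using lipschitz_onD[OF lip, of a b] ab(1) by (auto simp: dist_real_def)
      also have "\<dots> \<le> (K + 1) * (b - a)" using ab(1) by (intro mult_right_mono) auto
      also have "\<dots> < (K + 1) * (1 / Suc n)"
        using ab(3) h(2) K by (intro mult_strict_left_mono) auto
      also have "\<dots> < d" using n K by (simp add: pos_less_divide_eq mult.commute)
      finally have small: "\<phi> b - \<phi> a < d" .
      show "\<exists>a b. a < b \<and> y \<in> {a..b} \<and> b - a < d \<and> g b - g a \<le> 1 / r * (b - a)"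
      proof (intro exI conjI)
        show "\<phi> a < \<phi> b" "y \<in> {\<phi> a..\<phi> b}" using ab x(2) by (auto simp: less_iff le_iff)
        show "g (\<phi> b) - g (\<phi> a) \<le> 1 / r * (\<phi> b - \<phi> a)" using bar by (simp only: g')
      qed (rule small)
    qed (use \<phi>E in auto)
    also have "g ` (\<phi> ` ?E) = ?E" by (simp add: image_image g')
    also note mult_left_mono[OF 1]
    finally have 2: "emeasure lebesgue ?E \<le> ennreal (1 / r) * (ennreal p * emeasure lebesgue ?E)" by simp
    have fin: "emeasure lebesgue ?E < \<infinity>"
    proof -
      have "emeasure lebesgue ?E \<le> emeasure lebesgue {-m..m}" by (intro emeasure_mono) auto
      also have "\<dots> < \<infinity>" by (cases "-m \<le> m") auto
      finally show ?thesis .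
    qed
    then obtain e where e: "emeasure lebesgue ?E = ennreal e" "e \<ge> 0"
      by (metis ennreal_cases infinity_ennreal_def less_irrefl)
    have "e \<le> 1 / r * (p * e)" using 2 pr e(2) unfolding e(1)
      by (simp add: ennreal_mult[symmetric] del: times_divide_eq_left)
    then have "(r - p) * e \<le> 0" using pr by (simp add: field_simps)
    then have "e = 0" using pr e(2) by (simp add: mult_le_0_iff)
    then show ?thesis using e E by (auto simp: negligible_iff_null_sets intro!: null_setsI)
  qed
  have "{x. \<not> \<phi> differentiable (at x)} \<subseteq>
    (\<Union>p\<in>\<rat>\<inter>{0<..}. \<Union>r\<in>\<rat>\<inter>{p<..}. \<Union>m::nat. lo p \<inter> hi r \<inter> {-real m..real m})"
  proof
    fix x assume "x \<in> {x. \<not> \<phi> differentiable (at x)}"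
    then have nd: "\<not> \<phi> differentiable (at x)" by simp
    have q1: "1 \<le> q x h" if "h \<noteq> 0" for h
      using expand[of x "x + h"] expand[of "x + h" x] that
      by (cases "h > 0") (auto simp: q_def field_simps)
    have qK: "q x h \<le> K" if "h \<noteq> 0" for h
      using lipschitz_onD[OF lip, of "x+h" x] that
      by (cases "h > 0") (auto simp: q_def field_simps dist_real_def)
    let ?q = "\<lambda>h. ereal (q x h)"
    have ev: "\<forall>\<^sub>F h in at 0. h \<noteq> (0::real)" by (simp add: eventually_at_filter)
    have lo1: "1 \<le> Liminf (at 0) ?q"
      by (rule Liminf_bounded) (use ev q1 in \<open>auto elim!: eventually_mono\<close>)
    have hiK: "Limsup (at 0) ?q \<le> K"
      by (rule Limsup_bounded) (use ev qK in \<open>auto elim!: eventually_mono\<close>)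
    have le: "Liminf (at 0) ?q \<le> Limsup (at 0) ?q" by (rule Liminf_le_Limsup) simp
    have "Liminf (at 0) ?q \<noteq> Limsup (at 0) ?q"
    proof
      assume eq: "Liminf (at 0) ?q = Limsup (at 0) ?q"
      then have "\<bar>Limsup (at 0) ?q\<bar> \<noteq> \<infinity>" using lo1 hiK by auto
      then obtain D where D: "Limsup (at 0) ?q = ereal D" by auto
      have "(?q \<longlongrightarrow> ereal D) (at 0)"
        by (rule Liminf_eq_Limsup) (use eq D in auto)
      then have "(q x \<longlongrightarrow> D) (at 0)" by simp
      then have "DERIV \<phi> x :> D" unfolding DERIV_def q_def .
      then show False using nd by (auto simp: real_differentiable_def)
    qed
    then have lt: "Liminf (at 0) ?q < Limsup (at 0) ?q" using le by simp
    obtain p where p: "Liminf (at 0) ?q < ereal (of_rat p)" "ereal (of_rat p) < Limsup (at 0) ?q"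
      using ereal_dense3[OF lt] by auto
    obtain r where r: "ereal (of_rat p) < ereal (of_rat r)" "ereal (of_rat r) < Limsup (at 0) ?q"
      using ereal_dense3[OF p(2)] by auto
    have "1 < ereal (of_rat p)" using lo1 p(1) by (rule order_le_less_trans)
    then have p0: "0 < (of_rat p :: real)" by auto
    have fr: "\<exists>h. h \<noteq> 0 \<and> \<bar>h\<bar> < 1 / (Suc n) \<and> P h" if "\<exists>\<^sub>F h in at 0. P h" for P and n :: nat
    proof -
      have "\<forall>\<^sub>F h in at (0::real). h \<noteq> 0 \<and> \<bar>h\<bar> < 1 / (Suc n)"
        unfolding eventually_at by (intro exI[of _ "1 / real (Suc n)"]) (auto simp: dist_real_def)
      from frequently_ex[OF frequently_eventually_conj[OF that this]] show ?thesis by blast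
    qed
    have "\<exists>\<^sub>F h in at 0. q x h < of_rat p"
      using p(1) Liminf_bounded[of "ereal (of_rat p)" ?q "at 0"]
      by (auto simp: frequently_def not_less)
    from fr[OF this] have "x \<in> lo (of_rat p)" by (auto simp: lo_def)
    moreover have "\<exists>\<^sub>F h in at 0. of_rat r < q x h"
      using r(2) Limsup_bounded[of ?q "ereal (of_rat r)" "at 0"]
      by (auto simp: frequently_def not_less)
    from fr[OF this] have "x \<in> hi (of_rat r)" by (auto simp: hi_def)
    moreover obtain m :: nat where "\<bar>x\<bar> \<le> real m" using real_arch_simple by blast
    ultimately show "x \<in> (\<Union>p\<in>\<rat>\<inter>{0<..}. \<Union>r\<in>\<rat>\<inter>{p<..}. \<Union>m::nat. lo p \<inter> hi r \<inter> {-real m..real m})"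
      using p0 r(1) by (intro UN_I[of "of_rat p"] UN_I[of "of_rat r"] UN_I[of m]) auto
  qed
  moreover have "negligible (\<Union>p\<in>\<rat>\<inter>{0<..}. \<Union>r\<in>\<rat>\<inter>{p<..}. \<Union>m::nat. lo p \<inter> hi r \<inter> {-real m..real m})"
  proof -
    have Q: "countable (\<rat> \<inter> {p<..})" for p :: real by (rule countable_Int1[OF countable_rat])
    have "lo p \<inter> hi r \<inter> {-real m..real m} \<in> null_sets lebesgue"
      if "p \<in> \<rat> \<inter> {0<..}" "r \<in> \<rat> \<inter> {p<..}" for p r m
      using null[of p r "real m"] that by (simp only: negligible_iff_null_sets Int_iff greaterThan_iff)
    then have "(\<Union>m::nat. lo p \<inter> hi r \<inter> {-real m..real m}) \<in> null_sets lebesgue"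
      if "p \<in> \<rat> \<inter> {0<..}" "r \<in> \<rat> \<inter> {p<..}" for p r
      using that by (intro null_sets_UN)
    then show ?thesis
      unfolding negligible_iff_null_sets by (intro null_sets_UN'[OF Q])
  qed
  ultimately show ?thesis by (rule negligible_subset[rotated])
qed

text \<open>Adding a steep linear function turns a Lipschitz function into an expanding one without
  changing where it is differentiable.\<close>

lemma Lipschitz_differentiable_ae:
  fixes f :: "real \<Rightarrow> 'a::euclidean_space"
  assumes lip: "L-lipschitz_on UNIV f"
  shows "AE x in lebesgue. f differentiable (at x)"
proof -
  have L: "L \<ge> 0" using lip by (rule lipschitz_on_nonneg)
  have "AE x in lebesgue. (\<lambda>u. f u \<bullet> b) differentiable (at x)" if b: "b \<in> Basis" for b
  proof -
    have bnd: "\<bar>f x \<bullet> b - f y \<bullet> b\<bar> \<le> L * \<bar>x - y\<bar>" for x y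
      using Basis_le_norm[OF b, of "f x - f y"] lipschitz_onD[OF lip, of x y]
      by (simp add: dist_norm inner_diff_left)
    define \<phi> where "\<phi> u = f u \<bullet> b + (L + 1) * u" for u
    have "negligible {x. \<not> \<phi> differentiable (at x)}"
    proof (rule expanding_Lipschitz_differentiable_ae)
      fix x y :: real assume "x \<le> y"
      then show "y - x \<le> \<phi> y - \<phi> x" using bnd[of y x] by (auto simp: \<phi>_def algebra_simps)
    next
      show "(2 * L + 1)-lipschitz_on UNIV \<phi>"
      proof (rule lipschitz_onI)
        fix x y :: real
        have "\<phi> x - \<phi> y = (f x \<bullet> b - f y \<bullet> b) + (L + 1) * (x - y)"
          by (simp add: \<phi>_def algebra_simps)
        then have "\<bar>\<phi> x - \<phi> y\<bar> \<le> \<bar>f x \<bullet> b - f y \<bullet> b\<bar> + (L + 1) * \<bar>x - y\<bar>"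
          using L abs_triangle_ineq[of "f x \<bullet> b - f y \<bullet> b" "(L + 1) * (x - y)"] by (simp add: abs_mult)
        then show "dist (\<phi> x) (\<phi> y) \<le> (2 * L + 1) * dist x y"
          using bnd[of x y] by (simp add: dist_real_def algebra_simps)
      qed (use L in auto)
    qed
    then have ae: "AE x in lebesgue. \<phi> differentiable (at x)"
      by (intro AE_I'[of "{x. \<not> \<phi> differentiable (at x)}"]) (simp_all add: negligible_iff_null_sets)
    have *: "(\<lambda>u. f u \<bullet> b) differentiable (at x)" if "\<phi> differentiable (at x)" for x
    proof -
      have "(\<lambda>u. \<phi> u - (L + 1) * u) differentiable (at x)" using that by simp
      then show ?thesis by (simp add: \<phi>_def)
    qed
    from ae show ?thesis by eventually_elim (rule *)
  qed
  then have "AE x in lebesgue. \<forall>b\<in>Basis. (\<lambda>u. f u \<bullet> b) differentiable (at x)"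
    by (intro AE_finite_allI) auto
  then show ?thesis by eventually_elim (rule iffD2[OF differentiable_componentwise_within])
qed

section \<open>Speed and immersions\<close>

lemma has_vector_derivative_imp_quotient_tendsto:
  assumes "(f has_vector_derivative D) (at x)"
  shows "((\<lambda>h. (f (x + h) - f x) /\<^sub>R h) \<longlongrightarrow> D) (at 0)"
proof (rule LIM_zero_cancel, rule tendsto_norm_zero_cancel)
  have "((\<lambda>h. norm (f (x + h) - f x - h *\<^sub>R D) / norm h) \<longlongrightarrow> 0) (at 0)"
    using assms by (simp add: has_vector_derivative_def has_derivative_at)
  moreover have "\<forall>\<^sub>F h in at 0. norm (f (x + h) - f x - h *\<^sub>R D) / norm h
      = norm ((f (x + h) - f x) /\<^sub>R h - D)"
    unfolding eventually_at_filter
  proof (intro always_eventually allI impI)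
    fix h :: real assume "h \<noteq> 0"
    then have "(f (x + h) - f x) /\<^sub>R h - D = (f (x + h) - f x - h *\<^sub>R D) /\<^sub>R h"
      by (simp add: scaleR_diff_right)
    then show "norm (f (x + h) - f x - h *\<^sub>R D) / norm h = norm ((f (x + h) - f x) /\<^sub>R h - D)"
      by (simp add: divide_inverse mult.commute)
  qed
  ultimately show "((\<lambda>h. norm ((f (x + h) - f x) /\<^sub>R h - D)) \<longlongrightarrow> 0) (at 0)"
    by (rule Lim_transform_eventually)
qed

lemma norm_vector_derivative_le_lipschitz:
  fixes f :: "real \<Rightarrow> 'a::real_normed_vector"
  assumes "L-lipschitz_on UNIV f" "(f has_vector_derivative D) (at x)"
  shows "norm D \<le> L"
proof -
  have "((\<lambda>h. norm ((f (x + h) - f x) /\<^sub>R h)) \<longlongrightarrow> norm D) (at 0)"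
    using assms(2) by (intro tendsto_norm has_vector_derivative_imp_quotient_tendsto)
  then show ?thesis
  proof (rule tendsto_upperbound)
    show "\<forall>\<^sub>F h in at 0. norm ((f (x + h) - f x) /\<^sub>R h) \<le> L"
      unfolding eventually_at_filter
    proof (intro always_eventually allI impI)
      fix h :: real assume "h \<noteq> 0"
      moreover have "norm (f (x + h) - f x) \<le> L * \<bar>h\<bar>"
        using lipschitz_onD[OF assms(1), of "x + h" x] by (simp add: dist_norm)
      moreover have "norm ((f (x + h) - f x) /\<^sub>R h) = norm (f (x + h) - f x) / \<bar>h\<bar>"
        by (simp add: divide_inverse mult.commute)
      ultimately show "norm ((f (x + h) - f x) /\<^sub>R h) \<le> L"
        by (simp add: pos_divide_le_eq)
    qed
  qed simp
qed

text \<open>The derivative agrees almost everywhere with the limit of the difference quotients along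
  \<open>1/n\<close>, which is Borel measurable. Its arbitrary values on the remaining null set do no harm since
  Lebesgue measure is complete.\<close>

lemma measurable_vector_derivative_ae_differentiable:
  fixes f :: "real \<Rightarrow> 'a::euclidean_space"
  assumes cont: "continuous_on UNIV f" and diff: "AE x in lebesgue. f differentiable (at x)"
  shows "(\<lambda>x. vector_derivative f (at x)) \<in> borel_measurable lebesgue"
proof -
  define G where "G x = lim (\<lambda>n. real (Suc n) *\<^sub>R (f (x + 1 / Suc n) - f x))" for x
  have [measurable]: "f \<in> borel_measurable borel" using cont by (rule borel_measurable_continuous_onI)
  have "G \<in> borel_measurable lborel" unfolding G_def by measurable
  then have G: "G \<in> borel_measurable lebesgue" by (rule measurable_completion)
  have eq: "AE x in lebesgue. vector_derivative f (at x) = G x"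
    using diff
  proof eventually_elim
    fix x assume "f differentiable (at x)"
    then have "((\<lambda>h. (f (x + h) - f x) /\<^sub>R h) \<longlongrightarrow> vector_derivative f (at x)) (at 0)"
      by (intro has_vector_derivative_imp_quotient_tendsto) (simp add: vector_derivative_works)
    moreover have "filterlim (\<lambda>n. 1 / real (Suc n)) (at 0) sequentially"
      unfolding filterlim_at using LIMSEQ_Suc[OF lim_1_over_n] by simp
    ultimately have "(\<lambda>n. (f (x + 1 / Suc n) - f x) /\<^sub>R (1 / real (Suc n))) \<longlonglongrightarrow> vector_derivative f (at x)"
      by (rule filterlim_compose)
    then have "(\<lambda>n. real (Suc n) *\<^sub>R (f (x + 1 / Suc n) - f x)) \<longlonglongrightarrow> vector_derivative f (at x)"
      by simp
    then show "vector_derivative f (at x) = G x" unfolding G_def by (rule limI[symmetric])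
  qed
  show ?thesis
  proof (rule measurableI)
    fix A :: "'a set" assume A: "A \<in> sets borel"
    let ?d = "\<lambda>x. vector_derivative f (at x)"
    have "AE x in lebesgue. x \<in> G -` A \<inter> space lebesgue \<longleftrightarrow> x \<in> ?d -` A \<inter> space lebesgue"
      using eq by eventually_elim simp
    then show "?d -` A \<inter> space lebesgue \<in> sets lebesgue"
      using measurable_sets[OF G A] by (rule completion.in_sets_AE) simp
  qed simp
qed

text \<open>The essential supremum of a non-measurable function is infinite by convention, so
  the lower bound on the speed becomes a bound on the essential infimum only together with
  measurability.\<close>

lemma immersedI:
  assumes curve: "lipschitz_curve \<gamma>" and c: "c > 0"
    and diff: "AE u in lebesgue. \<gamma> differentiable (at u)"
    and speed: "AE u in lebesgue. c \<le> norm (vector_derivative \<gamma> (at u))"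
  shows "immersed \<gamma>"
proof -
  let ?f = "\<lambda>u. norm (vector_derivative \<gamma> (at u))"
  have "continuous_on UNIV \<gamma>"
    using curve lipschitz_on_continuous_on by (auto simp: lipschitz_curve_def)
  then have [measurable]: "(\<lambda>u. vector_derivative \<gamma> (at u)) \<in> borel_measurable lebesgue"
    using diff by (rule measurable_vector_derivative_ae_differentiable)
  have "esssup lebesgue (\<lambda>u. - ereal (?f u)) \<le> ereal (- c)"
  proof (rule esssup_I)
    show "(\<lambda>u. - ereal (?f u)) \<in> borel_measurable lebesgue" by measurable
    show "AE u in lebesgue. - ereal (?f u) \<le> ereal (- c)" using speed by eventually_elim simp
  qed
  then have "ereal c \<le> essinf lebesgue ?f"
    unfolding essinf_def using ereal_minus_le_minus by fastforce
  then have "essinf lebesgue ?f > 0" using c by (metis ereal_less(2) less_le_trans)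
  then show ?thesis using curve by (simp add: immersed_def)
qed

section \<open>Length of curves inside a knot\<close>

text \<open>A growth rate \<open>c\<close> on small intervals around almost every point integrates up, because a
  monotone function loses nothing on the exceptional set. In a tagged division fine enough
  for the gauge, the intervals tagged in \<open>N\<close> have small total length, since the indicator function of
  \<open>N\<close> has gauge integral zero; the other intervals grow at rate \<open>c\<close>. The functions \<open>v\<close>
  to which this is applied below are accumulated lengths and may jump.\<close>

lemma monotone_growth_ge_ae:
  fixes v :: "real \<Rightarrow> real"
  assumes ab: "a \<le> b" and N: "negligible N" and c: "c \<ge> 0"
    and mono: "\<And>y z. a \<le> y \<Longrightarrow> y \<le> z \<Longrightarrow> z \<le> b \<Longrightarrow> v y \<le> v z"
    and grow: "\<And>x. x \<in> {a..b} - N \<Longrightarrow> \<exists>d>0. \<forall>y z. a \<le> y \<longrightarrow> y \<le> x \<longrightarrow> x \<le> z \<longrightarrow> z \<le> b \<longrightarrow>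
      z - y < d \<longrightarrow> c * (z - y) \<le> v z - v y"
  shows "c * (b - a) \<le> v b - v a"
proof (rule field_le_epsilon)
  fix e :: real assume e: "0 < e"
  define \<eta> where "\<eta> = e / (c + 1)"
  have \<eta>: "0 < \<eta>" using c e by (simp add: \<eta>_def)
  have "((indicator N :: real \<Rightarrow> real) has_integral 0) (cbox a b)"
    using N unfolding negligible_def by blast
  then obtain G where G: "gauge G" and fineG: "\<And>p. p tagged_division_of cbox a b \<Longrightarrow> G fine p \<Longrightarrow>
      norm ((\<Sum>(x,K)\<in>p. measure lborel K *\<^sub>R (indicator N x :: real)) - 0) < \<eta>"
    using \<eta> unfolding has_integral by metis
  obtain d where d: "\<And>x. x \<in> {a..b} - N \<Longrightarrow> d x > 0 \<and> (\<forall>y z. a \<le> y \<longrightarrow> y \<le> x \<longrightarrow> x \<le> z \<longrightarrow> z \<le> b \<longrightarrow>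
      z - y < d x \<longrightarrow> c * (z - y) \<le> v z - v y)"
    using grow by metis
  define D where "D x = (if x \<in> {a..b} - N then ball x (d x / 2) else UNIV)" for x
  have "gauge D" using d by (auto simp: D_def gauge_def)
  then have "gauge (\<lambda>x. G x \<inter> D x)" using G by (intro gauge_Int)
  then obtain p where p: "p tagged_division_of {a..b}" and "(\<lambda>x. G x \<inter> D x) fine p"
    by (rule fine_division_exists_real)
  then have fp: "G fine p" "D fine p" by (auto simp: fine_Int)
  have one: "c * measure lborel K - c * (measure lborel K * indicator N x) \<le> v (Sup K) - v (Inf K)"
    if xK: "(x, K) \<in> p" for x K
  proof -
    obtain y z where K: "K = cbox y z" using tagged_division_ofD(4)[OF p xK] by blast
    have xinK: "x \<in> K" and Kab: "K \<subseteq> {a..b}" using tagged_division_ofD(2,3)[OF p xK] by auto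
    then have yz: "y \<le> x" "x \<le> z" "K = {y..z}" using K by auto
    then have abyz: "a \<le> y" "z \<le> b" using Kab by auto
    have eqs: "Sup K = z" "Inf K = y" "measure lborel K = z - y" using yz by auto
    show ?thesis
    proof (cases "x \<in> N")
      case True
      then show ?thesis using mono[of y z] yz abyz by (simp add: eqs)
    next
      case False
      then have xab: "x \<in> {a..b} - N" using xinK Kab by auto
      have "K \<subseteq> ball x (d x / 2)" using fp(2) xK xab by (force simp: fine_def D_def)
      moreover have "y \<in> K" "z \<in> K" using yz by auto
      ultimately have "\<bar>x - y\<bar> < d x / 2" "\<bar>x - z\<bar> < d x / 2" by (auto simp: dist_real_def)
      then have "c * (z - y) \<le> v z - v y" using d[OF xab] yz abyz by auto
      then show ?thesis using False by (simp add: eqs)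
    qed
  qed
  have "c * (b - a) - c * \<eta> \<le> c * (b - a) - c * (\<Sum>(x,K)\<in>p. measure lborel K * indicator N x)"
    using fineG[of p] p fp(1) c by (intro diff_left_mono mult_left_mono) (auto simp: abs_less_iff)
  also have len: "b - a = (\<Sum>(x,K)\<in>p. measure lborel K)"
    using additive_content_tagged_division[of p a b] p ab by simp
  also have "c * (\<Sum>(x,K)\<in>p. measure lborel K) - c * (\<Sum>(x,K)\<in>p. measure lborel K * indicator N x)
      = (\<Sum>(x,K)\<in>p. c * measure lborel K - c * (measure lborel K * indicator N x))"
    by (simp add: sum_distrib_left sum_subtractf split_beta)
  also have "\<dots> \<le> (\<Sum>(x,K)\<in>p. v (Sup K) - v (Inf K))"
    using one by (intro sum_mono) auto
  also have "\<dots> = v b - v a" using additive_tagged_division_1[OF ab p] .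
  finally have "c * (b - a) - c * \<eta> \<le> v b - v a" unfolding len .
  moreover have "c * \<eta> \<le> e" using c e by (simp add: \<eta>_def field_simps)
  ultimately show "c * (b - a) \<le> v b - v a + e" by simp
qed

text \<open>Any factor below 1 could replace \<open>1/2\<close>: at a point of differentiability the chords are nearly
  as long as the tangent vector predicts, also for chords that merely straddle the point.\<close>

lemma unit_speed_imp_local_growth:
  fixes \<gamma> :: "real \<Rightarrow> 'a::real_normed_vector"
  assumes "\<gamma> differentiable (at x)" "norm (vector_derivative \<gamma> (at x)) = 1"
  shows "\<exists>d>0. \<forall>y z. y \<le> x \<longrightarrow> x \<le> z \<longrightarrow> z - y < d \<longrightarrow> 1 / 2 * (z - y) \<le> dist (\<gamma> z) (\<gamma> y)"
proof -
  define D where "D = vector_derivative \<gamma> (at x)"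
  have "(\<gamma> has_derivative (\<lambda>h. h *\<^sub>R D)) (at x)"
    using assms(1) unfolding D_def by (simp add: vector_derivative_works has_vector_derivative_def)
  then obtain d where d: "d > 0"
    and lin: "\<And>y. norm (y - x) < d \<Longrightarrow> norm (\<gamma> y - \<gamma> x - (y - x) *\<^sub>R D) \<le> 1 / 2 * norm (y - x)"
    unfolding has_derivative_at_alt by (metis half_gt_zero_iff zero_less_one)
  show ?thesis
  proof (intro exI[of _ d] conjI allI impI d)
    fix y z assume yz: "y \<le> x" "x \<le> z" "z - y < d"
    have "z - y = norm ((z - y) *\<^sub>R D)" using assms(2) yz by (simp add: D_def)
    also have "(z - y) *\<^sub>R D = (\<gamma> z - \<gamma> y) - (\<gamma> z - \<gamma> x - (z - x) *\<^sub>R D) + (\<gamma> y - \<gamma> x - (y - x) *\<^sub>R D)"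
      by (simp add: algebra_simps)
    also have "norm \<dots> \<le> norm (\<gamma> z - \<gamma> y) + norm (\<gamma> z - \<gamma> x - (z - x) *\<^sub>R D)
        + norm (\<gamma> y - \<gamma> x - (y - x) *\<^sub>R D)"
      by (intro norm_triangle_mono norm_triangle_ineq4) simp
    also have "\<dots> \<le> norm (\<gamma> z - \<gamma> y) + 1 / 2 * (z - x) + 1 / 2 * (x - y)"
      using lin[of z] lin[of y] yz by (intro add_mono) auto
    finally show "1 / 2 * (z - y) \<le> dist (\<gamma> z) (\<gamma> y)" by (simp add: dist_norm field_simps)
  qed
qed

text \<open>The variation of \<open>g\<close> on \<open>[0, \<tau>]\<close>, written such that \<open>\<tau> = 1\<close> is literally
  \<^const>\<open>curve_length\<close>.\<close>

definition length_upto :: "(real \<Rightarrow> real^3) \<Rightarrow> real \<Rightarrow> ennreal" where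
  "length_upto g \<tau> = (SUP (n, t) \<in> {(n::nat, t::nat \<Rightarrow> real). mono t \<and> range t \<subseteq> {0..\<tau>}}.
     \<Sum>i<n. ennreal (dist (g (t i)) (g (t (Suc i)))))"

lemma length_upto_1: "length_upto g 1 = curve_length g"
  by (simp add: length_upto_def curve_length_def)

lemma length_upto_mono: "\<tau> \<le> \<tau>' \<Longrightarrow> length_upto g \<tau> \<le> length_upto g \<tau>'"
  unfolding length_upto_def by (rule SUP_subset_mono) auto

text \<open>A partition up to time \<open>\<tau>\<close> becomes one up to \<open>\<tau>'\<close> by appending these two times.\<close>

lemma length_upto_add_dist_le:
  assumes "0 \<le> \<tau>" "\<tau> \<le> \<tau>'"
  shows "length_upto g \<tau> + ennreal (dist (g \<tau>) (g \<tau>')) \<le> length_upto g \<tau>'"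
proof -
  let ?I = "{(n::nat, t::nat \<Rightarrow> real). mono t \<and> range t \<subseteq> {0..\<tau>}}"
  let ?S = "\<lambda>(n, t). \<Sum>i<n. ennreal (dist (g (t i)) (g (t (Suc i))))"
  have "(0, \<lambda>_. 0) \<in> ?I" using assms by (auto simp: mono_def)
  then have ne: "?I \<noteq> {}" by blast
  have "length_upto g \<tau> + ennreal (dist (g \<tau>) (g \<tau>'))
      = (SUP i\<in>?I. ?S i + ennreal (dist (g \<tau>) (g \<tau>')))"
    unfolding length_upto_def using ne by (rule ennreal_SUP_add_left[symmetric])
  also have "\<dots> \<le> length_upto g \<tau>'"
  proof (rule SUP_least)
    fix i assume "i \<in> ?I"
    then obtain n t where i: "i = (n, t)" and t: "mono t" "range t \<subseteq> {0..\<tau>}" by auto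
    define t' where "t' k = (if k \<le> n then t k else if k = Suc n then \<tau> else \<tau>')" for k
    have tb: "0 \<le> t k" "t k \<le> \<tau>" for k using subsetD[OF t(2), of "t k"] by auto
    have tb': "t k \<le> \<tau>'" for k using tb(2)[of k] assms(2) by (rule order_trans)
    then have "mono t'"
      unfolding mono_def t'_def using monoD[OF t(1)] tb assms by auto
    moreover have "range t' \<subseteq> {0..\<tau>'}" using tb tb' assms by (auto simp: t'_def)
    ultimately have mem: "(Suc (Suc n), t') \<in> {(n, t). mono t \<and> range t \<subseteq> {0..\<tau>'}}" by simp
    have "?S i = (\<Sum>i<n. ennreal (dist (g (t' i)) (g (t' (Suc i)))))"
      unfolding i prod.case by (intro sum.cong) (auto simp: t'_def)
    also have "\<dots> \<le> (\<Sum>i<Suc n. ennreal (dist (g (t' i)) (g (t' (Suc i)))))"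
      by (intro sum_mono2) auto
    finally have "?S i + ennreal (dist (g \<tau>) (g \<tau>')) \<le>
        (\<Sum>i<Suc n. ennreal (dist (g (t' i)) (g (t' (Suc i))))) + ennreal (dist (g \<tau>) (g \<tau>'))"
      by (rule add_right_mono)
    also have "\<dots> = ?S (Suc (Suc n), t')"
      unfolding prod.case sum.lessThan_Suc[of _ "Suc n"] by (simp only: t'_def) simp
    also have "\<dots> \<le> length_upto g \<tau>'"
      unfolding length_upto_def by (rule SUP_upper[OF mem])
    finally show "?S i + ennreal (dist (g \<tau>) (g \<tau>')) \<le> length_upto g \<tau>'" .
  qed
  finally show ?thesis .
qed

text \<open>The path \<open>g\<close> may wander back and forth along \<open>\<gamma>\<close>, but its parameter \<open>\<phi>\<close> passes every value
  \<open>u\<close> between \<open>\<phi> 0\<close> and \<open>\<phi> 1\<close>, and the times \<open>T u\<close> of the first visit are monotone in \<open>u\<close> by the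
  intermediate value theorem. Therefore \<open>v u\<close>, the length of \<open>g\<close> up to the first visit of \<open>u\<close>,
  grows at least as fast as the chords of \<open>\<gamma>\<close>, that is, at rate \<open>c\<close> near almost every parameter.\<close>

lemma curve_length_ge_parameter_distance:
  fixes \<gamma> :: "real \<Rightarrow> real^3"
  assumes N: "negligible N" and c: "0 \<le> c"
    and grow: "\<And>x. x \<notin> N \<Longrightarrow>
      \<exists>d>0. \<forall>y z. y \<le> x \<longrightarrow> x \<le> z \<longrightarrow> z - y < d \<longrightarrow> c * (z - y) \<le> dist (\<gamma> z) (\<gamma> y)"
    and cont: "continuous_on {0..1} \<phi>"
    and lift: "\<And>\<tau>. \<tau> \<in> {0..1} \<Longrightarrow> g \<tau> = \<gamma> (\<phi> \<tau>)"
  shows "ennreal (c * \<bar>\<phi> 1 - \<phi> 0\<bar>) \<le> curve_length g"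
proof (cases "curve_length g = \<infinity>")
  case False
  let ?S = "closed_segment (\<phi> 0) (\<phi> 1)"
  define T where "T u = Inf {\<tau> \<in> {0..1}. \<phi> \<tau> = u}" for u
  define v where "v u = enn2real (length_upto g (T u))" for u
  have hit: "\<exists>\<sigma>\<in>{0..\<tau>}. \<phi> \<sigma> = u" if "u \<in> closed_segment (\<phi> 0) (\<phi> \<tau>)" "\<tau> \<in> {0..1}" for u \<tau>
  proof -
    have c': "continuous_on {0..\<tau>} \<phi>" using cont that(2) by (auto intro: continuous_on_subset)
    show ?thesis
    proof (cases "\<phi> 0 \<le> \<phi> \<tau>")
      case True
      then show ?thesis using IVT'[of \<phi> 0 u \<tau>] that c' by (auto simp: closed_segment_eq_real_ivl)
    next
      case False
      then show ?thesis using IVT2'[of \<phi> \<tau> u 0] that c' by (auto simp: closed_segment_eq_real_ivl)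
    qed
  qed
  have Tmem: "T u \<in> {0..1}" "\<phi> (T u) = u" if u: "u \<in> ?S" for u
  proof -
    let ?A = "{\<tau> \<in> {0..1}. \<phi> \<tau> = u}"
    have "closed ({0..1} \<inter> \<phi> -` {u})" using cont by (intro continuous_closed_preimage) auto
    moreover have "{0..1} \<inter> \<phi> -` {u} = ?A" by auto
    ultimately have "closed ?A" by simp
    moreover have "?A \<noteq> {}" using hit[OF u] by auto
    moreover have "bdd_below ?A" by (auto intro!: bdd_belowI[of _ 0])
    ultimately have "T u \<in> ?A" unfolding T_def by (intro closed_contains_Inf)
    then show "T u \<in> {0..1}" "\<phi> (T u) = u" by auto
  qed
  have Tle: "T a \<le> T b" if b: "b \<in> ?S" and a: "a \<in> closed_segment (\<phi> 0) b" for a b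
  proof -
    obtain \<sigma> where \<sigma>: "\<sigma> \<in> {0..T b}" "\<phi> \<sigma> = a" using hit[of a "T b"] Tmem[OF b] a by auto
    moreover have "\<sigma> \<le> 1" using \<sigma>(1) Tmem(1)[OF b] by simp
    ultimately have "T a \<le> \<sigma>" unfolding T_def[of a]
      by (intro cInf_lower) (auto intro!: bdd_belowI[of _ 0])
    then show ?thesis using \<sigma>(1) by simp
  qed
  have fin: "length_upto g \<tau> < \<infinity>" if "\<tau> \<le> 1" for \<tau>
    using length_upto_mono[OF that, of g] False by (auto simp: length_upto_1 less_top[symmetric] top_unique)
  have vstep: "v a + dist (\<gamma> a) (\<gamma> b) \<le> v b"
    if b: "b \<in> ?S" and a: "a \<in> closed_segment (\<phi> 0) b" for a b
  proof -
    have a': "a \<in> ?S" using a b by (auto simp: closed_segment_eq_real_ivl split: if_splits)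
    have "length_upto g (T a) + ennreal (dist (g (T a)) (g (T b))) \<le> length_upto g (T b)"
      using Tmem(1)[OF a'] Tle[OF b a] by (intro length_upto_add_dist_le) auto
    moreover have "g (T a) = \<gamma> a" "g (T b) = \<gamma> b" using Tmem[OF a'] Tmem[OF b] lift by auto
    ultimately have "enn2real (length_upto g (T a) + ennreal (dist (\<gamma> a) (\<gamma> b))) \<le> v b"
      unfolding v_def using fin[of "T b"] Tmem(1)[OF b] by (intro enn2real_mono) auto
    then show ?thesis
      using fin[of "T a"] Tmem(1)[OF a'] by (simp add: v_def enn2real_plus)
  qed
  \<comment> \<open>If \<open>\<phi>\<close> moves to the left, then \<open>v\<close> is decreasing in \<open>u\<close>, and the growth argument is applied
    to \<open>-v\<close>.\<close>
  have "c * \<bar>\<phi> 1 - \<phi> 0\<bar> \<le> v (\<phi> 1) - v (\<phi> 0)"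
  proof (cases "\<phi> 0 \<le> \<phi> 1")
    case True
    have step: "dist (\<gamma> z) (\<gamma> y) \<le> v z - v y" if "\<phi> 0 \<le> y" "y \<le> z" "z \<le> \<phi> 1" for y z
      using vstep[of z y] that by (auto simp: closed_segment_eq_real_ivl dist_commute)
    have "c * (\<phi> 1 - \<phi> 0) \<le> v (\<phi> 1) - v (\<phi> 0)"
    proof (rule monotone_growth_ge_ae[OF True N c])
      show "v y \<le> v z" if "\<phi> 0 \<le> y" "y \<le> z" "z \<le> \<phi> 1" for y z
        using step[OF that] zero_le_dist[of "\<gamma> z" "\<gamma> y"] by linarith
      fix x assume "x \<in> {\<phi> 0..\<phi> 1} - N"
      then obtain d where d: "d > 0" and
        "\<And>y z. y \<le> x \<Longrightarrow> x \<le> z \<Longrightarrow> z - y < d \<Longrightarrow> c * (z - y) \<le> dist (\<gamma> z) (\<gamma> y)"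
        using grow[of x] by blast
      then show "\<exists>d>0. \<forall>y z. \<phi> 0 \<le> y \<longrightarrow> y \<le> x \<longrightarrow> x \<le> z \<longrightarrow> z \<le> \<phi> 1 \<longrightarrow> z - y < d \<longrightarrow>
          c * (z - y) \<le> v z - v y"
        using step by (intro exI[of _ d]) (meson order_trans)
    qed
    then show ?thesis using True by simp
  next
    case False
    then have le: "\<phi> 1 \<le> \<phi> 0" by simp
    have step: "dist (\<gamma> z) (\<gamma> y) \<le> - v z - (- v y)" if "\<phi> 1 \<le> y" "y \<le> z" "z \<le> \<phi> 0" for y z
    proof -
      have "y \<in> ?S" "z \<in> closed_segment (\<phi> 0) y" using that by (auto simp: closed_segment_eq_real_ivl)
      from vstep[OF this] show ?thesis by simp
    qed
    have "c * (\<phi> 0 - \<phi> 1) \<le> - v (\<phi> 0) - (- v (\<phi> 1))"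
    proof (rule monotone_growth_ge_ae[OF le N c])
      show "- v y \<le> - v z" if "\<phi> 1 \<le> y" "y \<le> z" "z \<le> \<phi> 0" for y z
        using step[OF that] zero_le_dist[of "\<gamma> z" "\<gamma> y"] by linarith
      fix x assume "x \<in> {\<phi> 1..\<phi> 0} - N"
      then obtain d where d: "d > 0" and
        "\<And>y z. y \<le> x \<Longrightarrow> x \<le> z \<Longrightarrow> z - y < d \<Longrightarrow> c * (z - y) \<le> dist (\<gamma> z) (\<gamma> y)"
        using grow[of x] by blast
      then show "\<exists>d>0. \<forall>y z. \<phi> 1 \<le> y \<longrightarrow> y \<le> x \<longrightarrow> x \<le> z \<longrightarrow> z \<le> \<phi> 0 \<longrightarrow> z - y < d \<longrightarrow>
          c * (z - y) \<le> - v z - (- v y)"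
        using step by (intro exI[of _ d]) (meson order_trans)
    qed
    then show ?thesis using le by simp
  qed
  also have "\<dots> \<le> v (\<phi> 1)" by (simp add: v_def)
  also have "\<dots> \<le> enn2real (curve_length g)"
    unfolding v_def length_upto_1[symmetric] using Tmem(1)[of "\<phi> 1"] fin[of 1]
    by (intro enn2real_mono length_upto_mono) auto
  finally have "ennreal (c * \<bar>\<phi> 1 - \<phi> 0\<bar>) \<le> ennreal (enn2real (curve_length g))"
    by (rule ennreal_leI)
  moreover have "curve_length g < top" using False by (simp add: less_top)
  ultimately show ?thesis by (simp only: ennreal_enn2real)
qed simp


section \<open>Paths in a knot and their parameters\<close>

lemma periodic_eq_int:
  assumes "periodic_fun_simple' f" "s - t \<in> \<int>"
  shows "f (s::real) = f t"
proof -
  interpret periodic_fun_simple' f by fact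
  obtain k where "s - t = of_int k" using assms(2) by (auto elim: Ints_cases)
  then show ?thesis using plus_of_int[of t k] by (simp add: algebra_simps)
qed

text \<open>The knot is homeomorphic to the unit circle via \<open>q (\<gamma> t) = e\<^sup>2\<^sup>\<pi>\<^sup>i\<^sup>t\<close>; continuity of \<open>q\<close> holds
  because the circle is compact. Then \<open>q \<circ> g\<close> is a continuous nonvanishing function on an interval and
  has a continuous logarithm, whose imaginary part divided by \<open>2 \<pi>\<close> is the lift.\<close>

lemma knot_path_lift:
  assumes \<gamma>: "knot \<gamma>" and g: "path g" "path_image g \<subseteq> range \<gamma>"
  obtains \<phi> where "continuous_on {0..1} \<phi>" "\<And>\<tau>. \<tau> \<in> {0..1} \<Longrightarrow> g \<tau> = \<gamma> (\<phi> \<tau>)"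
proof -
  have per: "periodic_fun_simple' \<gamma>" and cont: "continuous_on UNIV \<gamma>"
    and inj: "\<And>s t. \<gamma> s = \<gamma> t \<Longrightarrow> s - t \<in> \<int>"
    using \<gamma> by (auto simp: knot_def)
  define e where "e t = exp (complex_of_real (2 * pi * t) * \<i>)" for t :: real
  have e_int: "e s = e t" if st: "s - t \<in> \<int>" for s t
  proof -
    obtain k where "s - t = of_int k" using st by (auto elim: Ints_cases)
    then have s: "s = t + of_int k" by simp
    show ?thesis
      unfolding e_def exp_eq s by (intro exI[of _ k]) (simp add: algebra_simps)
  qed
  \<comment> \<open>The choice of the parameter is immaterial: any two differ by an integer, a period of \<open>e\<close>.\<close>
  define q where "q x = e (SOME t. \<gamma> t = x)" for x
  have q: "q (\<gamma> t) = e t" for t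
  proof -
    have "\<gamma> (SOME s. \<gamma> s = \<gamma> t) = \<gamma> t" by (rule someI) simp
    then show ?thesis unfolding q_def using inj e_int by blast
  qed
  have frac: "\<exists>t'\<in>{0..1}. \<gamma> t' = \<gamma> t" for t
    using periodic_eq_int[OF per, of "frac t" t]
    by (intro bexI[of _ "frac t"]) (auto simp: frac_def less_imp_le[OF frac_lt_1, unfolded frac_def])
  have range: "range \<gamma> = \<gamma> ` {0..1}" using frac by (auto simp: image_iff) metis
  have "continuous_on {0..1} \<gamma>" using cont by (rule continuous_on_subset) simp
  then have "compact (range \<gamma>)" unfolding range by (intro compact_continuous_image) auto
  then have "closed (range \<gamma>)" by (rule compact_imp_closed)
  have conte: "continuous_on S e" for S unfolding e_def by (intro continuous_intros)
  have "continuous_on (range \<gamma>) q"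
    unfolding continuous_on_closed_vimage[OF \<open>closed (range \<gamma>)\<close>]
  proof (intro allI impI)
    fix B :: "complex set" assume "closed B"
    then have "closed ({0..1} \<inter> e -` B)" by (intro continuous_closed_preimage conte) auto
    then have "compact ({0..1} \<inter> e -` B)" by (metis compact_Icc compact_Int_closed inf_left_idem)
    moreover have "continuous_on ({0..1} \<inter> e -` B) \<gamma>" using cont by (rule continuous_on_subset) simp
    ultimately have "compact (\<gamma> ` ({0..1} \<inter> e -` B))" by (intro compact_continuous_image)
    moreover have "q -` B \<inter> range \<gamma> = \<gamma> ` ({0..1} \<inter> e -` B)"
      unfolding range by (auto simp: q)
    ultimately show "closed (q -` B \<inter> range \<gamma>)" by (simp add: compact_imp_closed)
  qed
  then have "continuous_on {0..1} (\<lambda>\<tau>. q (g \<tau>))"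
    by (rule continuous_on_compose2[OF _ g(1)[unfolded path_def] g(2)[unfolded path_image_def]])
  moreover have "contractible {0..1::real}" by (intro convex_imp_contractible) simp
  moreover have "q x \<noteq> 0" for x by (simp add: q_def e_def)
  ultimately obtain \<psi> where \<psi>: "continuous_on {0..1} \<psi>"
    "\<And>\<tau>. \<tau> \<in> {0..1} \<Longrightarrow> q (g \<tau>) = exp (\<psi> \<tau>)"
    by (rule continuous_logarithm_on_contractible) blast
  define \<phi> where "\<phi> \<tau> = Im (\<psi> \<tau>) / (2 * pi)" for \<tau>
  show ?thesis
  proof (rule that[of \<phi>])
    show "continuous_on {0..1} \<phi>" unfolding \<phi>_def using \<psi>(1) by (intro continuous_intros) auto
    fix \<tau> :: real assume \<tau>: "\<tau> \<in> {0..1}"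
    then have "g \<tau> \<in> range \<gamma>" using g(2) by (auto simp: path_image_def)
    then obtain s where s: "g \<tau> = \<gamma> s" by auto
    have "exp (\<psi> \<tau>) = e s" using \<psi>(2)[OF \<tau>] by (simp add: s q)
    then obtain n :: int where "\<psi> \<tau> = complex_of_real (2 * pi * s) * \<i> + (of_int (2 * n) * pi) * \<i>"
      unfolding e_def exp_eq by blast
    then have "\<phi> \<tau> = s + of_int n" by (simp add: \<phi>_def field_simps)
    then show "g \<tau> = \<gamma> (\<phi> \<tau>)" using s periodic_eq_int[OF per, of "\<phi> \<tau>" s] by simp
  qed
qed

text \<open>The endpoints of the lifted path are parameters of \<open>\<gamma> s\<close> and \<open>\<gamma> t\<close>, hence agree with \<open>s\<close> and
  \<open>t\<close> up to integers. The factor 2 is the inverse of the growth rate \<open>1/2\<close>.\<close>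

lemma parameter_distance_le_intrinsic_dist:
  assumes knot: "knot \<gamma>" and arc: "arclength_parametrized \<gamma>"
    and less: "intrinsic_dist (range \<gamma>) (\<gamma> s) (\<gamma> t) < ennreal l"
  obtains k :: int where "\<bar>t + of_int k - s\<bar> \<le> 2 * l"
proof -
  have inj: "\<And>s t. \<gamma> s = \<gamma> t \<Longrightarrow> s - t \<in> \<int>"
    using knot by (auto simp: knot_def)
  have "AE u in lebesgue. \<gamma> differentiable (at u) \<and> norm (vector_derivative \<gamma> (at u)) = 1"
    using arc by (simp add: arclength_parametrized_def)
  then have "negligible {u. \<not> (\<gamma> differentiable (at u) \<and> norm (vector_derivative \<gamma> (at u)) = 1)}"
    (is "negligible ?N")
    by (simp only: completion.AE_iff_null_sets negligible_iff_null_sets space_completion space_lborel space_borel UNIV_I simp_thms)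
  obtain g where g: "path g" "path_image g \<subseteq> range \<gamma>" "pathstart g = \<gamma> s" "pathfinish g = \<gamma> t"
    and len: "curve_length g < ennreal l"
    using less unfolding intrinsic_dist_def INF_less_iff by blast
  obtain \<phi> where \<phi>: "continuous_on {0..1} \<phi>" "\<And>\<tau>. \<tau> \<in> {0..1} \<Longrightarrow> g \<tau> = \<gamma> (\<phi> \<tau>)"
    using knot_path_lift[OF knot g(1,2)] by blast
  have "ennreal (1 / 2 * \<bar>\<phi> 1 - \<phi> 0\<bar>) \<le> curve_length g"
    using \<open>negligible ?N\<close> _ _ \<phi>
  proof (rule curve_length_ge_parameter_distance)
    show "\<exists>d>0. \<forall>y z. y \<le> x \<longrightarrow> x \<le> z \<longrightarrow> z - y < d \<longrightarrow> 1 / 2 * (z - y) \<le> dist (\<gamma> z) (\<gamma> y)"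
      if "x \<notin> ?N" for x using that by (intro unit_speed_imp_local_growth) auto
  qed auto
  also note len
  finally have half: "1 / 2 * \<bar>\<phi> 1 - \<phi> 0\<bar> < l" by (simp add: ennreal_less_iff)
  have "\<gamma> (\<phi> 0) = \<gamma> s" "\<gamma> (\<phi> 1) = \<gamma> t"
    using g(3,4) \<phi>(2)[of 0] \<phi>(2)[of 1] by (auto simp: pathstart_def pathfinish_def)
  from this[THEN inj] obtain i j where "\<phi> 0 - s = of_int i" "\<phi> 1 - t = of_int j"
    by (auto elim!: Ints_cases)
  then have "\<phi> 1 - \<phi> 0 = t + of_int (j - i) - s" by simp
  with half show ?thesis by (intro that[of "j - i"]) simp
qed

text \<open>The two summands of the constant belong to the two ranges of \<open>|\<gamma> s - \<gamma> t|\<close>. At most \<open>2 r\<close>, the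
  distortion bound gives \<open>|t + k - s| \<le> 2 \<delta> |\<gamma> s - \<gamma> t|\<close> for some integer \<open>k\<close>. Beyond \<open>2 r\<close>, some
  \<open>t + k\<close> is within distance 1 of \<open>s\<close>, and \<open>L \<le> (L / 2 r) |\<gamma> s - \<gamma> t|\<close>.\<close>

lemma lipschitz_curve_dist_le_knot_dist:
  assumes knot: "knot \<gamma>" and arc: "arclength_parametrized \<gamma>"
    and r: "r > 0" and dist: "local_distortion (range \<gamma>) r < ennreal \<delta>" and \<delta>: "\<delta> > 0"
    and h: "periodic_fun_simple' h" "L-lipschitz_on UNIV h"
  shows "dist (h s) (h t) \<le> (2 * L * \<delta> + L / (2 * r)) * dist (\<gamma> s) (\<gamma> t)"
proof -
  have L: "L \<ge> 0" using h(2) by (rule lipschitz_on_nonneg)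
  have hk: "dist (h s) (h t) \<le> L * \<bar>t + of_int k - s\<bar>" for k :: int
  proof -
    have "h t = h (t + of_int k)" using periodic_eq_int[OF h(1), of "t + of_int k" t] by simp
    then show ?thesis using lipschitz_onD[OF h(2), of s "t + of_int k"]
      by (simp add: dist_real_def abs_minus_commute)
  qed
  have inj: "\<gamma> s = \<gamma> t \<Longrightarrow> s - t \<in> \<int>" using knot by (auto simp: knot_def)
  consider "\<gamma> s = \<gamma> t" | "\<gamma> s \<noteq> \<gamma> t" "dist (\<gamma> s) (\<gamma> t) \<le> 2 * r" | "dist (\<gamma> s) (\<gamma> t) > 2 * r"
    by linarith
  then show ?thesis
  proof cases
    case 1
    then show ?thesis using inj periodic_eq_int[OF h(1), of s t] by simp
  next
    case 2
    let ?d = "dist (\<gamma> s) (\<gamma> t)"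
    have d: "?d > 0" using 2 by simp
    have "intrinsic_dist (range \<gamma>) (\<gamma> s) (\<gamma> t) / ennreal ?d \<le> local_distortion (range \<gamma>) r"
      unfolding local_distortion_def using 2 by (intro SUP_upper2[of "(\<gamma> s, \<gamma> t)"]) auto
    also note dist
    finally have "intrinsic_dist (range \<gamma>) (\<gamma> s) (\<gamma> t) < ennreal \<delta> * ennreal ?d"
      using d by (simp add: divide_less_ennreal)
    then have "intrinsic_dist (range \<gamma>) (\<gamma> s) (\<gamma> t) < ennreal (\<delta> * ?d)"
      using \<delta> by (simp add: ennreal_mult)
    then obtain k :: int where k: "\<bar>t + of_int k - s\<bar> \<le> 2 * (\<delta> * ?d)"
      by (rule parameter_distance_le_intrinsic_dist[OF knot arc])
    have "dist (h s) (h t) \<le> L * (2 * (\<delta> * ?d))"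
      using hk[of k] mult_left_mono[OF k L] by linarith
    also have "\<dots> \<le> (2 * L * \<delta> + L / (2 * r)) * ?d"
      using L r by (simp add: algebra_simps)
    finally show ?thesis .
  next
    case 3
    let ?d = "dist (\<gamma> s) (\<gamma> t)"
    have "\<bar>t + of_int \<lfloor>s - t\<rfloor> - s\<bar> \<le> 1" by linarith
    then have "dist (h s) (h t) \<le> L" using hk[of "\<lfloor>s - t\<rfloor>"] L mult_left_le by (metis abs_ge_zero order_trans)
    also have "L \<le> L / (2 * r) * ?d" using 3 r L by (simp add: field_simps mult_left_mono)
    also have "\<dots> \<le> (2 * L * \<delta> + L / (2 * r)) * ?d"
      using L \<delta> by (intro mult_right_mono) auto
    finally show ?thesis .
  qed
qed

section \<open>Lipschitz perturbations of a knot of small local distortion\<close>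

theorem corollary1p4:
  fixes \<gamma> :: "real \<Rightarrow> real^3" and r :: real
  assumes "tame_knot \<gamma>"
    and "arclength_parametrized \<gamma>"
    and "r > 0"
    and "local_distortion (range \<gamma>) r < ennreal g\<^sub>3"
  shows "\<forall>h::real \<Rightarrow> real^3. lipschitz_curve h \<longrightarrow>
    (\<exists>\<epsilon>\<^sub>0>0. \<forall>\<epsilon>::real. \<bar>\<epsilon>\<bar> \<le> \<epsilon>\<^sub>0 \<longrightarrow>
       knot (\<lambda>u. \<gamma> u + \<epsilon> *\<^sub>R h u) \<and>
       immersed (\<lambda>u. \<gamma> u + \<epsilon> *\<^sub>R h u) \<and>
       knot_equivalent (\<lambda>u. \<gamma> u + \<epsilon> *\<^sub>R h u) \<gamma>)"
proof (intro allI impI)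
  fix h :: "real \<Rightarrow> real^3" assume "lipschitz_curve h"
  then obtain L where hper: "periodic_fun_simple' h" and L: "L-lipschitz_on UNIV h"
    by (auto simp: lipschitz_curve_def)
  have L0: "L \<ge> 0" using L by (rule lipschitz_on_nonneg)
  have knot: "knot \<gamma>" using assms(1) by (simp add: tame_knot_def)
  then have per: "periodic_fun_simple' \<gamma>" and cont: "continuous_on UNIV \<gamma>"
    and inj: "\<And>s t. \<gamma> s = \<gamma> t \<Longrightarrow> s - t \<in> \<int>" by (auto simp: knot_def)
  have curve: "lipschitz_curve \<gamma>"
    and speed: "AE u in lebesgue. \<gamma> differentiable (at u) \<and> norm (vector_derivative \<gamma> (at u)) = 1"
    using assms(2) by (auto simp: arclength_parametrized_def)
  obtain L\<^sub>\<gamma> where L\<gamma>: "L\<^sub>\<gamma>-lipschitz_on UNIV \<gamma>" using curve by (auto simp: lipschitz_curve_def)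
  have "g\<^sub>3 > 0"
  proof (rule ccontr)
    assume "\<not> g\<^sub>3 > 0"
    then show False using assms(4) by (simp add: ennreal_neg)
  qed
  define C where "C = 2 * L * g\<^sub>3 + L / (2 * r)"
  have C0: "C \<ge> 0" using L0 \<open>g\<^sub>3 > 0\<close> assms(3) by (simp add: C_def)
  have bilip: "dist (h s) (h t) \<le> C * dist (\<gamma> s) (\<gamma> t)" for s t
    unfolding C_def
    by (rule lipschitz_curve_dist_le_knot_dist[OF knot assms(2,3,4) \<open>g\<^sub>3 > 0\<close> hper L])
  \<comment> \<open>The map \<open>h \<circ> \<gamma>\<^sup>-\<^sup>1\<close> on the knot; the estimate above makes it well defined and Lipschitz.\<close>
  define f where "f x = h (SOME t. \<gamma> t = x)" for x
  have f: "f (\<gamma> t) = h t" for t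
  proof -
    have "\<gamma> (SOME s. \<gamma> s = \<gamma> t) = \<gamma> t" by (rule someI) simp
    then show ?thesis unfolding f_def using bilip[of "SOME s. \<gamma> s = \<gamma> t" t] by simp
  qed
  have "C-lipschitz_on (range \<gamma>) f" using bilip C0 by (intro lipschitz_onI) (auto simp: f)
  then obtain H where H: "(real DIM(real^3) * C)-lipschitz_on UNIV H" "\<And>x. x \<in> range \<gamma> \<Longrightarrow> H x = f x"
    by (rule lipschitz_extension) blast
  define M where "M = real DIM(real^3) * C"
  have M0: "M \<ge> 0" using C0 by (simp add: M_def)
  \<comment> \<open>Chosen such that \<open>\<epsilon> H\<close> is a contraction and \<open>\<epsilon> h\<close> has speed at most \<open>1/2\<close>.\<close>
  define \<epsilon>\<^sub>0 where "\<epsilon>\<^sub>0 = 1 / (2 * (M + L + 1))"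
  have "\<epsilon>\<^sub>0 > 0" using M0 L0 by (simp add: \<epsilon>\<^sub>0_def)
  moreover have "knot (\<lambda>u. \<gamma> u + \<epsilon> *\<^sub>R h u) \<and> immersed (\<lambda>u. \<gamma> u + \<epsilon> *\<^sub>R h u) \<and>
      knot_equivalent (\<lambda>u. \<gamma> u + \<epsilon> *\<^sub>R h u) \<gamma>" if \<epsilon>: "\<bar>\<epsilon>\<bar> \<le> \<epsilon>\<^sub>0" for \<epsilon>
  proof -
    have "\<bar>\<epsilon>\<bar> * (M + L + 1) \<le> \<epsilon>\<^sub>0 * (M + L + 1)" using \<epsilon> M0 L0 by (intro mult_right_mono) auto
    also have "\<epsilon>\<^sub>0 * (M + L + 1) = 1 / 2" using M0 L0 by (simp add: \<epsilon>\<^sub>0_def field_simps)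
    finally have "\<bar>\<epsilon>\<bar> * M + \<bar>\<epsilon>\<bar> * L + \<bar>\<epsilon>\<bar> \<le> 1 / 2" by (simp add: algebra_simps)
    moreover have "\<bar>\<epsilon>\<bar> * M \<ge> 0" "\<bar>\<epsilon>\<bar> * L \<ge> 0" using M0 L0 by auto
    ultimately have small: "\<bar>\<epsilon>\<bar> * M < 1" "\<bar>\<epsilon>\<bar> * L \<le> 1 / 2" by auto
    define \<Gamma> where "\<Gamma> u = \<gamma> u + \<epsilon> *\<^sub>R h u" for u
    have "(\<bar>\<epsilon>\<bar> * M)-lipschitz_on UNIV (\<lambda>x. \<epsilon> *\<^sub>R H x)"
      using H(1) unfolding M_def by (intro lipschitz_on_cmult)
    then obtain k where k: "homeomorphism UNIV UNIV (\<lambda>x. x + \<epsilon> *\<^sub>R H x) k"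
      using homeomorphism_id_plus_contraction small(1) by blast
    have k\<Gamma>: "k (\<Gamma> u) = \<gamma> u" for u
      using homeomorphism_apply1[OF k, of "\<gamma> u"] by (simp add: \<Gamma>_def H(2) f)
    have \<Gamma>per: "periodic_fun_simple' \<Gamma>"
      using per hper by (simp add: periodic_fun_simple'_def \<Gamma>_def)
    have \<Gamma>lip: "(L\<^sub>\<gamma> + \<bar>\<epsilon>\<bar> * L)-lipschitz_on UNIV \<Gamma>"
      unfolding \<Gamma>_def using L\<gamma> L by (intro lipschitz_on_add lipschitz_on_cmult)
    have "knot \<Gamma>"
      unfolding knot_def
    proof (intro conjI allI impI \<Gamma>per)
      show "continuous_on UNIV \<Gamma>" using \<Gamma>lip by (rule lipschitz_on_continuous_on)
      show "s - t \<in> \<int>" if "\<Gamma> s = \<Gamma> t" for s t using inj k\<Gamma> that by metis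
    qed
    moreover have "knot_equivalent \<Gamma> \<gamma>"
      unfolding knot_equivalent_def
      using homeomorphism_symD[OF k] by (intro exI conjI) (auto simp: image_image k\<Gamma>)
    moreover have "immersed \<Gamma>"
    proof (rule immersedI)
      show "lipschitz_curve \<Gamma>" using \<Gamma>per \<Gamma>lip by (auto simp: lipschitz_curve_def)
      have "AE u in lebesgue. \<Gamma> differentiable (at u) \<and> 1 / 2 \<le> norm (vector_derivative \<Gamma> (at u))"
        using speed Lipschitz_differentiable_ae[OF L]
      proof eventually_elim
        fix u assume a: "\<gamma> differentiable (at u) \<and> norm (vector_derivative \<gamma> (at u)) = 1"
          and b: "h differentiable (at u)"
        let ?D = "vector_derivative \<gamma> (at u)" and ?E = "vector_derivative h (at u)"
        have D: "(\<gamma> has_vector_derivative ?D) (at u)" and E: "(h has_vector_derivative ?E) (at u)"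
          using a b by (auto simp: vector_derivative_works)
        have DE: "(\<Gamma> has_vector_derivative (?D + \<epsilon> *\<^sub>R ?E)) (at u)"
          unfolding \<Gamma>_def using D E by (auto intro!: derivative_eq_intros)
        have "norm (\<epsilon> *\<^sub>R ?E) \<le> \<bar>\<epsilon>\<bar> * L"
          using norm_vector_derivative_le_lipschitz[OF L E] by (simp add: mult_left_mono)
        then have "1 / 2 \<le> norm (?D + \<epsilon> *\<^sub>R ?E)"
          using norm_diff_ineq[of ?D "\<epsilon> *\<^sub>R ?E"] a small(2) by linarith
        then show "\<Gamma> differentiable (at u) \<and> 1 / 2 \<le> norm (vector_derivative \<Gamma> (at u))"
          using DE vector_derivative_at[OF DE] by (auto simp: differentiable_def has_vector_derivative_def)
      qed
      then show "AE u in lebesgue. \<Gamma> differentiable (at u)"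
        "AE u in lebesgue. 1 / 2 \<le> norm (vector_derivative \<Gamma> (at u))" by auto
    qed simp
    ultimately show ?thesis unfolding \<Gamma>_def by blast
  qed
  ultimately show "\<exists>\<epsilon>\<^sub>0>0. \<forall>\<epsilon>::real. \<bar>\<epsilon>\<bar> \<le> \<epsilon>\<^sub>0 \<longrightarrow>
       knot (\<lambda>u. \<gamma> u + \<epsilon> *\<^sub>R h u) \<and> immersed (\<lambda>u. \<gamma> u + \<epsilon> *\<^sub>R h u) \<and>
       knot_equivalent (\<lambda>u. \<gamma> u + \<epsilon> *\<^sub>R h u) \<gamma>" by blast
qed

end
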